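(* For every integer $n\ge 1$ let $(G^3_n,\boldsymbol c^3_n)$ be the EWMCP instance and $\mathscr C^3_n$ the coloring of $G^3_n$ defined in the context, and let $\prec^3_n$ be any total order of the independent sets in $\mathscr C^3_n$. Then $$\frac{\mathrm{UB}_1(G^3_n,\boldsymbol c^3_n,\mathscr C^3_n)}{\mathrm{UB}_2(G^3_n,\boldsymbol c^3_n,\mathscr C^3_n,\prec^3_n)}\to+\infty\quad\text{as } n\to+\infty .$$
   Context: An instance of the Edge-Weighted Maximum Clique Problem (EWMCP) is a pair $(G,\boldsymbol c)$ where $G=(V,E)$ is a finite simple undirected graph and $\boldsymbol c=(c_e)_{e\in E}$ is a vector of nonnegative integer edge-weights. For $u\in V$, $\delta(u)\subseteq E$ is the set of edges incident to $u$. A coloring $\mathscr C$ of the vertices of $G$ is a partition of $V$ into disjoint non-empty independent sets (sets of pairwise non-adjacent vertices). First upper bound. $\mathrm{UB}_1(G,\boldsymbol c,\mathscr C)$ is the optimal value of the linear program, in real variables $\pi_I$ ($I\in\mathscr C$) and $\varrho_{eu},\varrho_{ev}$ (for each edge $e=\{u,v\}\in E$), $$\min \sum_{I\in\mathscr C}\pi_I$$ subject to $\varrho_{eu}+\varrho_{ev}=c_e$ for every $e=\{u,v\}\in E$; $\pi_I\ge\sum_{e\in\delta(u)}\varrho_{eu}$ for every $I\in\mathscr C$ and $u\in I$; and $\pi_I\ge0$, $\varrho_{eu}\ge0$, $\varrho_{ev}\ge0$ for all $I\in\mathscr C$ and all $e=\{u,v\}\in E$. Second upper bound. Let $\prec$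 be a (strict) total order on the coloring $\mathscr C$, and let $I(u)\in\mathscr C$ denote the unique member of $\mathscr C$ containing $u\in V$. For $u\in V$ set $$\sigma_u:=\sum_{I\in\mathscr C:\,I\prec I(u)}\max\{c_e: e=\{u,v\}\in\delta(u),\ v\in I\},$$ where the maximum is $0$ if no such edge exists. Then $$\mathrm{UB}_2(G,\boldsymbol c,\mathscr C,\prec):=\sum_{I\in\mathscr C}\max\{\sigma_u:u\in I\}.$$ The instances. For every integer $n\ge1$, $G^3_n$ is the complete bipartite graph with vertex set $\{1,\dots,2n\}$ and parts $I=\{1,\dots,n\}$ and $J=\{n+1,\dots,2n\}$: there are no edges inside $I$ or inside $J$, and every vertex of $I$ is adjacent to every vertex of $J$. Every edge has weight $1$; these weights define $\boldsymbol c^3_n$. The coloring is $\mathscr C^3_n=\{I,J\}$. *)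

theory Defs
  imports Complex_Main "HOL-Library.Disjoint_Sets"
begin

record 'a ugraph =
  verts :: "'a set"
  edges :: "'a set set"

definition simple_graph :: "'a ugraph \<Rightarrow> bool" where
  "simple_graph G \<longleftrightarrow> finite (verts G) \<and> (\<forall>e\<in>edges G. e \<subseteq> verts G \<and> card e = 2)"

definition incident :: "'a ugraph \<Rightarrow> 'a \<Rightarrow> 'a set set" where
  "incident G u = {e \<in> edges G. u \<in> e}"

definition independent_set :: "'a ugraph \<Rightarrow> 'a set \<Rightarrow> bool" where
  "independent_set G S \<longleftrightarrow> S \<subseteq> verts G \<and> (\<forall>u\<in>S. \<forall>v\<in>S. {u, v} \<notin> edges G)"

definition coloring :: "'a ugraph \<Rightarrow> 'a set set \<Rightarrow> bool" where
  "coloring G C \<longleftrightarrow> partition_on (verts G) C \<and> (\<forall>I\<in>C. independent_set G I)"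

text \<open>
  Edge weights are functions on sets of vertices; only the values on edges matter.
  In the linear program, \<open>\<rho> e u\<close> is the share of the weight of the edge \<open>e\<close> that is
  assigned to its endpoint \<open>u\<close>; only the values with \<open>e \<in> edges G\<close> and \<open>u \<in> e\<close> matter,
  and similarly for \<open>\<pi> I\<close> with \<open>I \<in> C\<close>.
\<close>

definition UB1_feasible ::
  "'a ugraph \<Rightarrow> ('a set \<Rightarrow> nat) \<Rightarrow> 'a set set \<Rightarrow> ('a set \<Rightarrow> real) \<Rightarrow> ('a set \<Rightarrow> 'a \<Rightarrow> real) \<Rightarrow> bool"
where
  "UB1_feasible G c C \<pi> \<rho> \<longleftrightarrow>
     (\<forall>u v. {u, v} \<in> edges G \<longrightarrow> \<rho> {u, v} u + \<rho> {u, v} v = real (c {u, v})) \<and>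
     (\<forall>I\<in>C. \<forall>u\<in>I. \<pi> I \<ge> (\<Sum>e\<in>incident G u. \<rho> e u)) \<and>
     (\<forall>I\<in>C. \<pi> I \<ge> 0) \<and>
     (\<forall>e\<in>edges G. \<forall>u\<in>e. \<rho> e u \<ge> 0)"

definition UB1 :: "'a ugraph \<Rightarrow> ('a set \<Rightarrow> nat) \<Rightarrow> 'a set set \<Rightarrow> real" where
  "UB1 G c C = Inf {(\<Sum>I\<in>C. \<pi> I) | \<pi> \<rho>. UB1_feasible G c C \<pi> \<rho>}"

text \<open>
  The infimum of reals is only meaningful for a nonempty set that is bounded below, which
  is the case for every simple graph.
\<close>

lemma UB1_values_nonempty:
  assumes "simple_graph G"
  shows "{(\<Sum>I\<in>C. \<pi> I) | \<pi> \<rho>. UB1_feasible G c C \<pi> \<rho>} \<noteq> {}"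
proof -
  have "edges G \<subseteq> Pow (verts G)" and "finite (verts G)"
    using assms by (auto simp: simple_graph_def)
  then have fin: "finite (edges G)"
    by (meson finite_Pow_iff finite_subset)
  have "(\<Sum>e\<in>incident G u. real (c e) / 2) \<le> (\<Sum>e\<in>edges G. real (c e))" for u
  proof -
    have "(\<Sum>e\<in>incident G u. real (c e) / 2) \<le> (\<Sum>e\<in>incident G u. real (c e))"
      by (intro sum_mono) simp
    also have "\<dots> \<le> (\<Sum>e\<in>edges G. real (c e))"
      by (intro sum_mono2 fin) (auto simp: incident_def)
    finally show ?thesis .
  qed
  then have "UB1_feasible G c C (\<lambda>_. \<Sum>e\<in>edges G. real (c e)) (\<lambda>e _. real (c e) / 2)"
    unfolding UB1_feasible_def by (auto intro: sum_nonneg)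
  then show ?thesis by blast
qed

lemma UB1_values_bdd_below:
  "bdd_below {(\<Sum>I\<in>C. \<pi> I) | \<pi> \<rho>. UB1_feasible G c C \<pi> \<rho>}"
  by (rule bdd_belowI[where m = 0]) (auto simp: UB1_feasible_def intro: sum_nonneg)

definition color_class :: "'a set set \<Rightarrow> 'a \<Rightarrow> 'a set" where
  "color_class C u = (THE I. I \<in> C \<and> u \<in> I)"

text \<open>
  Orders on a coloring are given as strict relations: \<open>(I, J) \<in> r\<close> means that \<open>I\<close>
  precedes \<open>J\<close>.
\<close>

definition total_order_of :: "'a set \<Rightarrow> ('a \<times> 'a) set \<Rightarrow> bool" where
  "total_order_of A r \<longleftrightarrow> r \<subseteq> A \<times> A \<and> strict_linear_order_on A r"

text \<open>
  Inserting \<open>0\<close> makes the maximum \<open>0\<close> when \<open>u\<close> has no neighbor in \<open>I\<close>, and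
  changes nothing otherwise, as weights are natural numbers.
\<close>

definition UB2_sigma ::
  "'a ugraph \<Rightarrow> ('a set \<Rightarrow> nat) \<Rightarrow> 'a set set \<Rightarrow> ('a set \<times> 'a set) set \<Rightarrow> 'a \<Rightarrow> nat"
where
  "UB2_sigma G c C r u =
     (\<Sum>I | I \<in> C \<and> (I, color_class C u) \<in> r.
        Max (insert 0 {c e | e. e \<in> incident G u \<and> (\<exists>v\<in>I. e = {u, v})}))"

definition UB2 ::
  "'a ugraph \<Rightarrow> ('a set \<Rightarrow> nat) \<Rightarrow> 'a set set \<Rightarrow> ('a set \<times> 'a set) set \<Rightarrow> nat"
where
  "UB2 G c C r = (\<Sum>I\<in>C. Max (UB2_sigma G c C r ` I))"

definition G3 :: "nat \<Rightarrow> nat ugraph" where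
  "G3 n = \<lparr>verts = {1..2 * n}, edges = {{u, v} | u v. u \<in> {1..n} \<and> v \<in> {n + 1..2 * n}}\<rparr>"

definition c3 :: "nat \<Rightarrow> nat set \<Rightarrow> nat" where
  "c3 n e = 1"

definition C3 :: "nat \<Rightarrow> nat set set" where
  "C3 n = {{1..n}, {n + 1..2 * n}}"

lemma simple_graph_G3: "simple_graph (G3 n)"
  by (auto simp: simple_graph_def G3_def card_insert_if)

lemma coloring_C3: "n \<ge> 1 \<Longrightarrow> coloring (G3 n) (C3 n)"
  by (auto simp: coloring_def partition_on_def independent_set_def disjoint_def G3_def C3_def
      doubleton_eq_iff)

end

theory Submission
  imports Defs
begin

text \<open>
  The point is that the first bound has to pay for every edge, whereas the second one pays
  at most one maximal edge weight for each pair of classes.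

  The shares of the edge weights at a vertex of a class \<open>I\<close> sum to at most \<open>\<pi> I\<close>.  Adding this
  up over all vertices, each edge contributes its two shares, hence its whole weight; so the
  total weight is at most the sum of \<open>card I * \<pi> I\<close> over all classes (lemma
  \<open>total_weight_le_of_feasible\<close>).  When all classes have at most \<open>k\<close> elements, the first
  bound is therefore at least the total weight divided by \<open>k\<close>
  (lemma \<open>total_weight_le_UB1\<close>).  For the complete bipartite graph the total weight is
  \<open>n * n\<close> and the classes have \<open>n\<close> elements, so the first bound is at least \<open>n\<close>.

  The second bound is always 1: a vertex of the first class has no preceding class, and a
  vertex of the second class sees exactly one, from which it collects the maximum of its edge
  weights, and these are all 1 (lemma \<open>UB2_G3\<close>).  The quotient is thus at least \<open>n\<close>.
\<close>

lemma sum_doubleton_shares: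
  assumes feas: "UB1_feasible G c C \<pi> \<rho>" and G: "simple_graph G" and e: "e \<in> edges G"
  shows "(\<Sum>u\<in>e. \<rho> e u) = real (c e)"
proof -
  obtain u v where "e = {u, v}" "u \<noteq> v"
    using G e unfolding simple_graph_def by (metis card_2_iff)
  then show ?thesis
    using feas e unfolding UB1_feasible_def by auto
qed

text \<open>
  Double counting of the pairs of an edge and one of its endpoints: grouped by edges, the shares
  give the total weight; grouped by vertices, each is bounded by the variable of its class.
\<close>

lemma total_weight_le_of_feasible:
  assumes G: "simple_graph G" and C: "coloring G C" and feas: "UB1_feasible G c C \<pi> \<rho>"
  shows "(\<Sum>e\<in>edges G. real (c e)) \<le> (\<Sum>I\<in>C. real (card I) * \<pi> I)"
proof -
  have finV: "finite (verts G)" and sub: "edges G \<subseteq> Pow (verts G)"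
    using G by (auto simp: simple_graph_def)
  then have finE: "finite (edges G)"
    by (meson finite_Pow_iff finite_subset)
  have part: "\<Union>C = verts G" "disjoint C"
    using C by (auto simp: coloring_def partition_on_def)
  have finI: "finite I" if "I \<in> C" for I
    using that part(1) finV by (metis Union_upper finite_subset)
  have "(\<Sum>e\<in>edges G. real (c e)) = (\<Sum>e\<in>edges G. \<Sum>u\<in>e. \<rho> e u)"
    using sum_doubleton_shares[OF feas G] by simp
  also have "\<dots> = (\<Sum>e\<in>edges G. \<Sum>u | u \<in> verts G \<and> u \<in> e. \<rho> e u)"
    using sub by (intro sum.cong) auto
  also have "\<dots> = (\<Sum>u\<in>verts G. \<Sum>e\<in>incident G u. \<rho> e u)"
    unfolding incident_def by (rule sum.swap_restrict[OF finE finV])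
  also have "\<dots> = (\<Sum>I\<in>C. \<Sum>u\<in>I. \<Sum>e\<in>incident G u. \<rho> e u)"
    unfolding part(1)[symmetric]
    using finI part(2) by (subst sum.Union_disjoint) (auto simp: disjoint_def)
  also have "\<dots> \<le> (\<Sum>I\<in>C. \<Sum>u\<in>I. \<pi> I)"
    using feas by (intro sum_mono) (auto simp: UB1_feasible_def)
  finally show ?thesis by simp
qed

lemma total_weight_le_UB1:
  assumes G: "simple_graph G" and C: "coloring G C"
    and k: "k \<ge> 1" "\<And>I. I \<in> C \<Longrightarrow> card I \<le> k"
  shows "(\<Sum>e\<in>edges G. real (c e)) / real k \<le> UB1 G c C"
  unfolding UB1_def
proof (rule cInf_greatest[OF UB1_values_nonempty[OF G]])
  fix x assume "x \<in> {(\<Sum>I\<in>C. \<pi> I) | \<pi> \<rho>. UB1_feasible G c C \<pi> \<rho>}"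
  then obtain \<pi> \<rho> where x: "x = (\<Sum>I\<in>C. \<pi> I)" and feas: "UB1_feasible G c C \<pi> \<rho>"
    by blast
  have "(\<Sum>e\<in>edges G. real (c e)) \<le> (\<Sum>I\<in>C. real (card I) * \<pi> I)"
    by (rule total_weight_le_of_feasible[OF G C feas])
  also have "\<dots> \<le> (\<Sum>I\<in>C. real k * \<pi> I)"
    using feas k(2) by (intro sum_mono mult_right_mono) (auto simp: UB1_feasible_def)
  also have "\<dots> = real k * x"
    by (simp add: x sum_distrib_left)
  finally show "(\<Sum>e\<in>edges G. real (c e)) / real k \<le> x"
    using k(1) by (simp add: field_simps)
qed

lemma card_edges_G3: "card (edges (G3 n)) = n * n"
proof -
  have "edges (G3 n) = (\<lambda>(u, v). {u, v}) ` ({1..n} \<times> {n + 1..2 * n})"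
    unfolding G3_def by force
  moreover have "inj_on (\<lambda>(u, v). {u, v}) ({1..n} \<times> {n + 1..2 * n})"
    by (auto simp: inj_on_def doubleton_eq_iff)
  ultimately show ?thesis
    by (simp add: card_image card_cartesian_product)
qed

lemma UB1_G3_ge:
  assumes "n \<ge> 1"
  shows "real n \<le> UB1 (G3 n) (c3 n) (C3 n)"
proof -
  have "card I \<le> n" if "I \<in> C3 n" for I
    using that by (auto simp: C3_def)
  from total_weight_le_UB1[OF simple_graph_G3 coloring_C3[OF assms] assms this, of "c3 n"]
  show ?thesis
    using assms by (simp add: c3_def card_edges_G3)
qed

lemma color_class_eq:
  assumes "coloring G C" "I \<in> C" "u \<in> I"
  shows "color_class C u = I"
  unfolding color_class_def
  using assms by (intro the_equality) (auto simp: coloring_def partition_on_def disjoint_def)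

lemma edge_between_classes_G3:
  assumes "C3 n = {X, Y}" "X \<noteq> Y" "u \<in> Y" "v \<in> X"
  shows "{u, v} \<in> edges (G3 n)"
proof -
  have "X = {1..n} \<and> Y = {n + 1..2 * n} \<or> Y = {1..n} \<and> X = {n + 1..2 * n}"
    using assms(1,2) by (auto simp: C3_def doubleton_eq_iff)
  then have "u \<in> {1..n} \<and> v \<in> {n + 1..2 * n} \<or> v \<in> {1..n} \<and> u \<in> {n + 1..2 * n}"
    using assms(3,4) by auto
  then show ?thesis
    unfolding G3_def by (auto simp: insert_commute)
qed

text \<open>
  The graph is symmetric in its two classes, so only the names \<open>X\<close> and \<open>Y\<close> of the first and the
  second class in the order matter.
\<close>

lemma UB2_G3:
  assumes n: "n \<ge> 1" and r: "total_order_of (C3 n) r"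
  shows "UB2 (G3 n) (c3 n) (C3 n) r = 1"
proof -
  have neq: "{1..n} \<noteq> {n + 1..2 * n}"
    using n by (auto simp: set_eq_iff)
  have "({1..n}, {n + 1..2 * n}) \<in> r \<or> ({n + 1..2 * n}, {1..n}) \<in> r"
    using r neq unfolding total_order_of_def strict_linear_order_on_def total_on_def C3_def
    by blast
  then obtain X Y where XY: "C3 n = {X, Y}" "X \<noteq> Y" "(X, Y) \<in> r"
    using neq unfolding C3_def by (metis insert_commute)
  have irr: "(X, X) \<notin> r" "(Y, Y) \<notin> r" and asym: "(Y, X) \<notin> r"
    using r XY(3) unfolding total_order_of_def strict_linear_order_on_def irrefl_def
    by (auto dest: transD)
  have ne: "X \<noteq> {}" "Y \<noteq> {}"
    using XY(1) n by (auto simp: C3_def doubleton_eq_iff)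
  note col = coloring_C3[OF n]
  have X0: "UB2_sigma (G3 n) (c3 n) (C3 n) r u = 0" if "u \<in> X" for u
  proof -
    have "color_class (C3 n) u = X"
      using color_class_eq[OF col _ that] XY(1) by simp
    then have no_pred: "{I. I \<in> C3 n \<and> (I, color_class (C3 n) u) \<in> r} = {}"
      using XY(1) irr asym by auto
    show ?thesis
      unfolding UB2_sigma_def no_pred by simp
  qed
  have Y1: "UB2_sigma (G3 n) (c3 n) (C3 n) r u = 1" if u: "u \<in> Y" for u
  proof -
    have "color_class (C3 n) u = Y"
      using color_class_eq[OF col _ u] XY(1) by simp
    then have preds: "{I. I \<in> C3 n \<and> (I, color_class (C3 n) u) \<in> r} = {X}"
      using XY irr by auto
    have weights:
      "{c3 n e | e. e \<in> incident (G3 n) u \<and> (\<exists>v\<in>X. e = {u, v})} = {1}"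
      using ne(1) edge_between_classes_G3[OF XY(1,2) u]
      by (fastforce simp: c3_def incident_def)
    show ?thesis
      unfolding UB2_sigma_def preds by (simp add: weights del: One_nat_def)
  qed
  have "UB2_sigma (G3 n) (c3 n) (C3 n) r ` X = {0}" "UB2_sigma (G3 n) (c3 n) (C3 n) r ` Y = {1}"
    using X0 Y1 ne by (auto simp: image_iff)
  then show ?thesis
    unfolding UB2_def using XY(1,2) by simp
qed

theorem proposition4:
  fixes prec :: "nat \<Rightarrow> (nat set \<times> nat set) set"
  assumes "\<And>n. n \<ge> 1 \<Longrightarrow> total_order_of (C3 n) (prec n)"
  shows "filterlim (\<lambda>n. UB1 (G3 n) (c3 n) (C3 n) / real (UB2 (G3 n) (c3 n) (C3 n) (prec n)))
           at_top sequentially"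
proof (rule filterlim_at_top_mono[OF filterlim_real_sequentially])
  show "\<forall>\<^sub>F n in sequentially.
          real n \<le> UB1 (G3 n) (c3 n) (C3 n) / real (UB2 (G3 n) (c3 n) (C3 n) (prec n))"
    using eventually_ge_at_top[of 1]
  proof eventually_elim
    case (elim n)
    then show ?case
      using UB1_G3_ge[OF elim] UB2_G3[OF elim assms[OF elim]] by simp
  qed
qed

end
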